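(* Let $D$ be an oriented diagram, with $n$ crossings, of an oriented knot $K\subset S^3$, let $M$ be the exterior of $K$ with two open balls removed, and let segment variables satisfying the gluing equations of $\mathcal T_4$ be given. Let $p_1,\dots,p_n\in\mathbb C^*/\{\pm1\}$ satisfy the $p$-relations up to sign for all segments of $D$, and let $\mathcal B_i:e(\overline o_i)\to\mathrm{SL}(2,\mathbb C)$ $(1\le i\le n)$ be the corresponding natural cocycles on the truncated octahedra. Then the $\mathcal B_i$ are well-glued after projecting them to $\mathrm{PSL}(2,\mathbb C)$: whenever edges of the truncated octahedra are identified in $M$, the corresponding matrices agree in $\mathrm{PSL}(2,\mathbb C)$. In particular, they form a natural cocycle $\mathcal B:e(M)\to\mathrm{PSL}(2,\mathbb C)$.
   Context: **Labels at a crossing.** The diagram is viewed from above. A segment of $D$ is an edge of $D$ regarded as a 4-valent graph. At a crossing (positive or negative) let $a$ be the incoming under-segment and $a,b,c,d$ the four segments in counterclockwise order; so $c$ is the outgoing under-segment and $b,d$ are over-segments. Segment variables there are $z_a,z_b,z_c,z_d$. **Octahedral decomposition and $\mathcal T_4$.** Let $p\ne q$ be two points of $S^3\setminus K$ (above and below the diagram). $S^3\setminus(K\cup\{p,q\})$ is a union of ideal octahedra $o_1,\dots,o_n$, one per crossing. The octahedron at a crossing has top vertex $v_\infty$ on the over-strand, bottom vertex $v_0$ on the under-strand, and side vertices $v_a,v_b,v_c,v_d$ in the directions of $a,b,c,d$. The vertices $v_a,v_c$ are at $p$, and $v_b,v_d$ are at $q$; $v_0,v_\infty$ are at the knot. Every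 face has one vertex of each type (knot, $p$, $q$). For each segment $s$ and each of its two sides, at each end of $s$ take the face spanned by $v_\infty$ if $s$ is over there ($v_0$ if $s$ is under there), $v_s$, and the neighbouring side vertex on that side of $s$; the two faces so obtained from the two ends of $s$ are glued, matching vertex types. $\mathcal T_4$ is obtained by dividing each octahedron into the four tetrahedra around the axis $v_0v_\infty$. Truncating decomposes $M$ into truncated tetrahedra; $e(M)$ and $e(\overline o_i)$ denote the oriented edges of $M$ and of the truncated octahedron $\overline o_i$ (so subdivided). Edges in the boundary (around truncated vertices) are short-edges, the others long-edges. **Segment variables and gluing equations of $\mathcal T_4$.** Nonzero complex numbers assigned to segments, distinct for two segments sharing a crossing. For a segment with variable $z_C$, drawn from left to right, let $z_A,z_B$ be the variables of the two transversal segments at its left end and $z_D,z_E$ those at its right end, with $A,D$ on one side and $B,E$ on the other. The equation for this segment is - (i) over at left, under at right: $\frac{z_C-z_A}{z_C-z_B}\cdot\frac{z_D(z_C-z_E)}{z_E(z_C-z_D)}=1$; - (ii) under at left, over at right: $\frac{z_A(z_C-z_B)}{z_B(z_C-z_A)}\cdot\frac{z_C-z_D}{z_C-z_E}=1$; - (iii) over at both: $\frac{z_C-z_A}{z_C-z_B}\cdot\frac{z_C-z_E}{z_C-z_D}=1$; - (iv) under at both: $\frac{z_A(z_C-z_B)}{z_B(z_C-z_A)}\cdot\frac{z_E(z_C-z_D)}{z_D(z_C-z_E)}=1$. **The $p$-relations.** With the same notation, and $i,j$ the indices of the octahedra at the left and right end of the segment, the relation for the segment is, in cases (i)–(iv)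 respectively, up to sign: $p_i\sqrt{1-\frac{z_B}{z_C}}=p_j\sqrt{1-\frac{z_C}{z_E}}$; $\ p_i\sqrt{1-\frac{z_C}{z_B}}=p_j\sqrt{1-\frac{z_E}{z_C}}$; $\ p_i\sqrt{1-\frac{z_B}{z_C}}=p_j\sqrt{1-\frac{z_E}{z_C}}$; $\ p_i\sqrt{1-\frac{z_C}{z_B}}=p_j\sqrt{1-\frac{z_C}{z_E}}$. (By the gluing equations it does not matter which side of the segment carries $B,E$.) **Natural cocycles.** $P$ is the group of upper triangular matrices with ones on the diagonal. A natural $(G,P)$-cocycle ($G=\mathrm{SL}(2,\mathbb C)$ or $\mathrm{PSL}(2,\mathbb C)$) assigns to oriented edges $e$ elements $\mathcal B(e)\in G$ with $\mathcal B(e)\mathcal B(-e)=I$, product $I$ around every (triangular or hexagonal) face, $\mathcal B(e)\in P$ on short-edges, and $\mathcal B(e)$ counter-diagonal on long-edges. **The cocycle $\mathcal B_i$.** At the crossing of $o_i$ let $r=\sqrt{z_c-z_a}$ if the crossing is positive, $r=\sqrt{z_a-z_c}$ if it is negative, and define vectors in $\mathbb C^2$: $V_a=\frac{p_i}{r}\binom{z_a}{r^2},\ V_c=\frac{p_i}{r}\binom{z_c}{r^2},\ V_b=p_ir\binom{1/r^2}{1/z_b},\ V_d=p_ir\binom{1/r^2}{1/z_d},\ V_\infty=\binom10,\ V_0=\binom{0}{-r\sqrt{1/z_d-1/z_b}}.$ The Ptolemy coordinate of the oriented edge from $v_x$ to $v_y$ is $\det(V_x,V_y)$. For a vertex of $\overline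 o_i$ lying near $v_x$ on the edge $v_xv_y$ let $C_{xy}\in\mathrm{SL}(2,\mathbb C)$ have columns $V_x$ and $V_y/\det(V_x,V_y)$. Then $\mathcal B_i(e)=C_{xy}^{-1}C_{x'y'}$ for an edge $e$ from the vertex indexed $xy$ to that indexed $x'y'$. Changing the choices of square roots or the sign of $p_i$ does not change $\mathcal B_i$ in $\mathrm{PSL}(2,\mathbb C)$. *)

theory Defs
  imports "HOL-Analysis.Determinants" "HOL-Algebra.Coset"
begin

section \<open>Oriented knot diagrams\<close>

text \<open>
  A diagram with crossings \<open>0, \<dots>, n - 1\<close> is given by planar-diagram data. The four segment
  ends at a crossing are its slots: \<open>Pa\<close> is the incoming under-end, and \<open>Pa, Pb, Pc, Pd\<close> follow
  each other counterclockwise, the diagram being viewed from above.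
\<close>

datatype position = Pa | Pb | Pc | Pd

fun next_pos :: "position \<Rightarrow> position" where
  "next_pos Pa = Pb" | "next_pos Pb = Pc" | "next_pos Pc = Pd" | "next_pos Pd = Pa"

fun prev_pos :: "position \<Rightarrow> position" where
  "prev_pos Pa = Pd" | "prev_pos Pb = Pa" | "prev_pos Pc = Pb" | "prev_pos Pd = Pc"

definition over_pos :: "position \<Rightarrow> bool" where
  "over_pos x \<longleftrightarrow> x = Pb \<or> x = Pd"

type_synonym slot = "nat \<times> position"

record 's diagram =
  crossings :: nat
  positive :: "nat \<Rightarrow> bool"
  seg :: "slot \<Rightarrow> 's"

text \<open>
  At a positive crossing the over-strand runs from \<open>Pd\<close> to \<open>Pb\<close>, at a negative one
  from \<open>Pb\<close> to \<open>Pd\<close>.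
\<close>

definition outgoing :: "'s diagram \<Rightarrow> slot set" where
  "outgoing D = {(i, x). i < crossings D \<and> (x = Pc \<or> x = (if positive D i then Pb else Pd))}"

definition incoming :: "'s diagram \<Rightarrow> slot set" where
  "incoming D = {(i, x). i < crossings D \<and> (x = Pa \<or> x = (if positive D i then Pd else Pb))}"

definition segments :: "'s diagram \<Rightarrow> 's set" where
  "segments D = seg D ` ({..<crossings D} \<times> UNIV)"

definition joins :: "'s diagram \<Rightarrow> slot \<Rightarrow> slot \<Rightarrow> bool" where
  "joins D u v \<longleftrightarrow> u \<in> outgoing D \<and> v \<in> incoming D \<and> seg D u = seg D v"

definition continues :: "'s diagram \<Rightarrow> 's \<Rightarrow> 's \<Rightarrow> bool" where
  "continues D s t \<longleftrightarrow>
     (\<exists>i x. (i, x) \<in> incoming D \<and> s = seg D (i, x) \<and> t = seg D (i, next_pos (next_pos x)))"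

text \<open>
  The two sides of a segment are taken with respect to its direction of travel. A segment leaves
  its first crossing and points towards its second one, so its left-hand neighbour is the
  counterclockwise next slot at the first crossing but the previous slot at the second one.
\<close>

datatype side = LeftSide | RightSide

fun start_neighbour :: "side \<Rightarrow> position \<Rightarrow> position" where
  "start_neighbour LeftSide x = next_pos x"
| "start_neighbour RightSide x = prev_pos x"

fun end_neighbour :: "side \<Rightarrow> position \<Rightarrow> position" where
  "end_neighbour LeftSide y = prev_pos y"
| "end_neighbour RightSide y = next_pos y"

text \<open>
  A corner of the diagram at a crossing is given by the two neighbouring slots that bound it.
  Walking along the sides of the segments links the corners; the classes are the regions
  (complementary faces) of the ribbon graph of the diagram.
\<close>

definition corners :: "'s diagram \<Rightarrow> (nat \<times> position set) set" where
  "corners D = {(i, {x, next_pos x}) | i x. i < crossings D}"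

definition linked_corners ::
  "'s diagram \<Rightarrow> nat \<times> position set \<Rightarrow> nat \<times> position set \<Rightarrow> bool" where
  "linked_corners D c c' \<longleftrightarrow>
     (\<exists>i x j y sd. joins D (i, x) (j, y) \<and>
        c = (i, {x, start_neighbour sd x}) \<and> c' = (j, {y, end_neighbour sd y}))"

definition regions :: "'s diagram \<Rightarrow> (nat \<times> position set) set set" where
  "regions D = corners D // {(c, c'). equivclp (linked_corners D) c c'}"

text \<open>
  The last condition is Euler's formula \<open>n - 2n + F = 2\<close>: the ribbon graph, connected because
  there is only one component, lies on the sphere. It also forces \<open>n > 0\<close>.
\<close>

definition oriented_knot_diagram :: "'s diagram \<Rightarrow> bool" where
  "oriented_knot_diagram D \<longleftrightarrow>
     inj_on (seg D) (outgoing D) \<and> inj_on (seg D) (incoming D) \<and>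
     seg D ` outgoing D = seg D ` incoming D \<and>
     (\<forall>s\<in>segments D. \<forall>t\<in>segments D. (continues D)\<^sup>*\<^sup>* s t) \<and>
     card (regions D) = crossings D + 2"

section \<open>Segment variables, gluing equations and p-relations\<close>

text \<open>
  Injectivity at each crossing says that the four variables there are pairwise distinct.
  In particular a segment with both ends at neighbouring slots of one crossing (a kink) admits
  no segment variables: its gluing equation would be undefined.
\<close>

definition segment_variables :: "'s diagram \<Rightarrow> ('s \<Rightarrow> complex) \<Rightarrow> bool" where
  "segment_variables D z \<longleftrightarrow>
     (\<forall>s\<in>segments D. z s \<noteq> 0) \<and> (\<forall>i<crossings D. inj (\<lambda>x. z (seg D (i, x))))"

fun gluing_equation ::
  "bool \<Rightarrow> bool \<Rightarrow> complex \<Rightarrow> complex \<Rightarrow> complex \<Rightarrow> complex \<Rightarrow> complex \<Rightarrow> bool" where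
  "gluing_equation True False zA zB zC zD zE \<longleftrightarrow>
     (zC - zA) / (zC - zB) * (zD * (zC - zE) / (zE * (zC - zD))) = 1"
| "gluing_equation False True zA zB zC zD zE \<longleftrightarrow>
     zA * (zC - zB) / (zB * (zC - zA)) * ((zC - zD) / (zC - zE)) = 1"
| "gluing_equation True True zA zB zC zD zE \<longleftrightarrow>
     (zC - zA) / (zC - zB) * ((zC - zE) / (zC - zD)) = 1"
| "gluing_equation False False zA zB zC zD zE \<longleftrightarrow>
     zA * (zC - zB) / (zB * (zC - zA)) * (zE * (zC - zD) / (zD * (zC - zE))) = 1"

text \<open>
  Segments are drawn in their direction of travel, with \<open>A, D\<close> on the left-hand side and
  \<open>B, E\<close> on the right-hand side.
\<close>

definition satisfies_gluing_equations :: "'s diagram \<Rightarrow> ('s \<Rightarrow> complex) \<Rightarrow> bool" where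
  "satisfies_gluing_equations D z \<longleftrightarrow>
     (\<forall>i x j y. joins D (i, x) (j, y) \<longrightarrow>
        gluing_equation (over_pos x) (over_pos y)
          (z (seg D (i, start_neighbour LeftSide x)))
          (z (seg D (i, start_neighbour RightSide x)))
          (z (seg D (i, x)))
          (z (seg D (j, end_neighbour LeftSide y)))
          (z (seg D (j, end_neighbour RightSide y))))"

definition equal_up_to_sign :: "complex \<Rightarrow> complex \<Rightarrow> bool" where
  "equal_up_to_sign u v \<longleftrightarrow> u = v \<or> u = - v"

fun p_relation ::
  "bool \<Rightarrow> bool \<Rightarrow> complex \<Rightarrow> complex \<Rightarrow> complex \<Rightarrow> complex \<Rightarrow> complex \<Rightarrow> bool" where
  "p_relation True False p1 p2 zB zC zE \<longleftrightarrow>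
     equal_up_to_sign (p1 * csqrt (1 - zB / zC)) (p2 * csqrt (1 - zC / zE))"
| "p_relation False True p1 p2 zB zC zE \<longleftrightarrow>
     equal_up_to_sign (p1 * csqrt (1 - zC / zB)) (p2 * csqrt (1 - zE / zC))"
| "p_relation True True p1 p2 zB zC zE \<longleftrightarrow>
     equal_up_to_sign (p1 * csqrt (1 - zB / zC)) (p2 * csqrt (1 - zE / zC))"
| "p_relation False False p1 p2 zB zC zE \<longleftrightarrow>
     equal_up_to_sign (p1 * csqrt (1 - zC / zB)) (p2 * csqrt (1 - zC / zE))"

definition satisfies_p_relations ::
  "'s diagram \<Rightarrow> ('s \<Rightarrow> complex) \<Rightarrow> (nat \<Rightarrow> complex) \<Rightarrow> bool" where
  "satisfies_p_relations D z p \<longleftrightarrow>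
     (\<forall>i x j y. joins D (i, x) (j, y) \<longrightarrow>
        p_relation (over_pos x) (over_pos y) (p i) (p j)
          (z (seg D (i, start_neighbour RightSide x)))
          (z (seg D (i, x)))
          (z (seg D (j, end_neighbour RightSide y))))"

section \<open>Matrix groups and natural cocycles\<close>

definition SL2 :: "(complex^2^2) monoid" where
  "SL2 = \<lparr>carrier = {A. det A = 1}, mult = (**), one = mat 1\<rparr>"

definition PSL2 :: "(complex^2^2) set monoid" where
  "PSL2 = SL2 Mod {mat 1, - mat 1}"

definition psl :: "complex^2^2 \<Rightarrow> (complex^2^2) set" where
  "psl A = {mat 1, - mat 1} #>\<^bsub>SL2\<^esub> A"

definition unipotent :: "(complex^2^2) set" where
  "unipotent = {A. A $ 1 $ 1 = 1 \<and> A $ 2 $ 1 = 0 \<and> A $ 2 $ 2 = 1}"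

definition counter_diagonal :: "(complex^2^2) set" where
  "counter_diagonal = {A \<in> carrier SL2. A $ 1 $ 1 = 0 \<and> A $ 2 $ 2 = 0}"

text \<open>
  The combinatorics of a space decomposed into truncated tetrahedra: all edges are oriented, and
  a (triangular or hexagonal) face is given by the lists of edges running around it.
\<close>

record 'e truncated_complex =
  short_edges :: "'e set"
  long_edges :: "'e set"
  reverse_edge :: "'e \<Rightarrow> 'e"
  faces :: "'e list set"

definition edges :: "'e truncated_complex \<Rightarrow> 'e set" where
  "edges X = short_edges X \<union> long_edges X"

definition natural_cocycle ::
  "'g monoid \<Rightarrow> 'g set \<Rightarrow> 'g set \<Rightarrow> 'e truncated_complex \<Rightarrow> ('e \<Rightarrow> 'g) \<Rightarrow> bool" where
  "natural_cocycle G P N X \<beta> \<longleftrightarrow>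
     (\<forall>e\<in>edges X. \<beta> e \<in> carrier G \<and> \<beta> e \<otimes>\<^bsub>G\<^esub> \<beta> (reverse_edge X e) = \<one>\<^bsub>G\<^esub>) \<and>
     (\<forall>F\<in>faces X. foldr (\<lambda>e g. \<beta> e \<otimes>\<^bsub>G\<^esub> g) F \<one>\<^bsub>G\<^esub> = \<one>\<^bsub>G\<^esub>) \<and>
     (\<forall>e\<in>short_edges X. \<beta> e \<in> P) \<and>
     (\<forall>e\<in>long_edges X. \<beta> e \<in> N)"

section \<open>The truncated octahedron and the decomposition of the exterior\<close>

datatype overtex = V0 | Vinf | Side position

text \<open>The truncation vertex near \<open>x\<close> on the edge \<open>xy\<close> is the pair \<open>(x, y)\<close>.\<close>

type_synonym oedge = "(overtex \<times> overtex) \<times> (overtex \<times> overtex)"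

definition tetrahedra :: "overtex set set" where
  "tetrahedra = range (\<lambda>x. {V0, Vinf, Side x, Side (next_pos x)})"

definition truncated_octahedron :: "oedge truncated_complex" where
  "truncated_octahedron =
    \<lparr>short_edges = {((x, y), (x, z)) | x y z.
        \<exists>T\<in>tetrahedra. {x, y, z} \<subseteq> T \<and> distinct [x, y, z]},
     long_edges = {((x, y), (y, x)) | x y.
        \<exists>T\<in>tetrahedra. {x, y} \<subseteq> T \<and> x \<noteq> y},
     reverse_edge = prod.swap,
     faces =
       {[((x, y), (x, z)), ((x, z), (x, t)), ((x, t), (x, y))] | x y z t.
          \<exists>T\<in>tetrahedra. {x, y, z, t} \<subseteq> T \<and> distinct [x, y, z, t]} \<union>
       {[((x, y), (y, x)), ((y, x), (y, z)), ((y, z), (z, y)),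
         ((z, y), (z, x)), ((z, x), (x, z)), ((x, z), (x, y))] | x y z.
          \<exists>T\<in>tetrahedra. {x, y, z} \<subseteq> T \<and> distinct [x, y, z]}\<rparr>"

datatype ideal_type = Knot_type | P_type | Q_type

fun vertex_type :: "overtex \<Rightarrow> ideal_type" where
  "vertex_type V0 = Knot_type"
| "vertex_type Vinf = Knot_type"
| "vertex_type (Side x) = (if over_pos x then Q_type else P_type)"

fun edge_vertices :: "oedge \<Rightarrow> overtex set" where
  "edge_vertices ((x, y), (x', y')) = {x, y, x', y'}"

fun edge_type :: "oedge \<Rightarrow> ideal_type list" where
  "edge_type ((x, y), (x', y')) =
     [vertex_type x, vertex_type y, vertex_type x', vertex_type y']"

text \<open>
  The octahedral face used at an end of a segment: \<open>x\<close> is the slot of that end, \<open>t\<close> its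
  neighbour on the chosen side.
\<close>

definition end_face :: "position \<Rightarrow> position \<Rightarrow> overtex set" where
  "end_face x t = {if over_pos x then Vinf else V0, Side x, Side t}"

text \<open>
  An edge of the disjoint union of the truncated octahedra is a pair of a crossing and an edge.
  As the three vertices of a face have different types, matching types determines the pairing.
\<close>

definition glued_edges :: "'s diagram \<Rightarrow> nat \<times> oedge \<Rightarrow> nat \<times> oedge \<Rightarrow> bool" where
  "glued_edges D u v \<longleftrightarrow>
     (\<exists>i x j y sd e f. u = (i, e) \<and> v = (j, f) \<and> joins D (i, x) (j, y) \<and>
        e \<in> edges truncated_octahedron \<and> f \<in> edges truncated_octahedron \<and>
        edge_vertices e \<subseteq> end_face x (start_neighbour sd x) \<and>
        edge_vertices f \<subseteq> end_face y (end_neighbour sd y) \<and>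
        edge_type e = edge_type f)"

definition edge_class :: "'s diagram \<Rightarrow> nat \<times> oedge \<Rightarrow> (nat \<times> oedge) set" where
  "edge_class D u = {v. equivclp (glued_edges D) u v}"

text \<open>
  The decomposition of the knot exterior with two open balls removed: the truncated octahedra
  with their faces glued.
\<close>

definition exterior_complex :: "'s diagram \<Rightarrow> (nat \<times> oedge) set truncated_complex" where
  "exterior_complex D =
    \<lparr>short_edges = edge_class D ` ({..<crossings D} \<times> short_edges truncated_octahedron),
     long_edges = edge_class D ` ({..<crossings D} \<times> long_edges truncated_octahedron),
     reverse_edge = image (map_prod id (reverse_edge truncated_octahedron)),
     faces = {map (\<lambda>e. edge_class D (i, e)) F | i F.
                i < crossings D \<and> F \<in> faces truncated_octahedron}\<rparr>"

section \<open>The cocycle at a crossing\<close>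

text \<open>
  The parameter \<open>r\<close> is the square root depending on the sign of the crossing, and \<open>w\<close> stands
  for the square root of \<open>1 / z Pd - 1 / z Pb\<close>.
\<close>

definition crossing_roots ::
  "'s diagram \<Rightarrow> ('s \<Rightarrow> complex) \<Rightarrow> (nat \<Rightarrow> complex) \<Rightarrow> (nat \<Rightarrow> complex) \<Rightarrow> bool" where
  "crossing_roots D z r w \<longleftrightarrow>
     (\<forall>i<crossings D.
        (r i)\<^sup>2 = (if positive D i then z (seg D (i, Pc)) - z (seg D (i, Pa))
                              else z (seg D (i, Pa)) - z (seg D (i, Pc))) \<and>
        (w i)\<^sup>2 = 1 / z (seg D (i, Pd)) - 1 / z (seg D (i, Pb)))"

fun crossing_vector ::
  "(position \<Rightarrow> complex) \<Rightarrow> complex \<Rightarrow> complex \<Rightarrow> complex \<Rightarrow> overtex \<Rightarrow> complex^2" where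
  "crossing_vector z p r w (Side x) =
     (if over_pos x then (p * r) *s vector [1 / r\<^sup>2, 1 / z x]
      else (p / r) *s vector [z x, r\<^sup>2])"
| "crossing_vector z p r w Vinf = vector [1, 0]"
| "crossing_vector z p r w V0 = vector [0, - r * w]"

definition columns2 :: "complex^2 \<Rightarrow> complex^2 \<Rightarrow> complex^2^2" where
  "columns2 u v = transpose (vector [u, v])"

definition ptolemy :: "(overtex \<Rightarrow> complex^2) \<Rightarrow> overtex \<Rightarrow> overtex \<Rightarrow> complex" where
  "ptolemy V x y = det (columns2 (V x) (V y))"

definition vertex_matrix :: "(overtex \<Rightarrow> complex^2) \<Rightarrow> overtex \<times> overtex \<Rightarrow> complex^2^2" where
  "vertex_matrix V = (\<lambda>(x, y). columns2 (V x) ((1 / ptolemy V x y) *s V y))"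

definition crossing_cocycle ::
  "'s diagram \<Rightarrow> ('s \<Rightarrow> complex) \<Rightarrow> (nat \<Rightarrow> complex) \<Rightarrow> (nat \<Rightarrow> complex) \<Rightarrow> (nat \<Rightarrow> complex)
    \<Rightarrow> nat \<Rightarrow> oedge \<Rightarrow> complex^2^2" where
  "crossing_cocycle D z p r w i = (\<lambda>(u, v).
     let V = crossing_vector (\<lambda>x. z (seg D (i, x))) (p i) (r i) (w i)
     in matrix_inv (vertex_matrix V u) ** vertex_matrix V v)"

end

theory Submission
  imports Defs
begin

text \<open>
  A short-edge from \<open>xy\<close> to \<open>xz\<close> carries the unipotent matrix with entry
  \<open>det(V\<^sub>z, V\<^sub>y) / (det(V\<^sub>x, V\<^sub>z) det(V\<^sub>x, V\<^sub>y))\<close>, and a long-edge a counter-diagonal matrix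
  determined by its Ptolemy coordinate. So it suffices that the Ptolemy coordinates of two glued
  faces agree up to one sign attached to the knot vertex.

  Let \<open>L = 1 - u / o\<close> for the under-variable \<open>u\<close> and over-variable \<open>o\<close> of a face, and let
  \<open>z\<^sub>C\<close> be the variable of the segment at the face. The Ptolemy coordinates are
  \<open>PQ = - p\<^sup>2 L\<close> and \<open>KP = z\<^sub>C KQ\<close>, and \<open>KP KQ\<close> is the difference of the values of \<open>p\<^sup>2 L\<close> on the
  two sides of the segment. The p-relation says that \<open>p\<^sup>2 L\<close> agrees at both ends of the segment
  on one side, and the gluing equation carries this over to the other side.
\<close>

section \<open>Ptolemy coordinates and transition matrices\<close>

lemma mat2_eq_iff:
  fixes A B :: "'a^2^2"
  shows "A = B \<longleftrightarrow> A$1$1 = B$1$1 \<and> A$1$2 = B$1$2 \<and> A$2$1 = B$2$1 \<and> A$2$2 = B$2$2"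
  by (auto simp: vec_eq_iff forall_2)

lemma det_columns2: "det (columns2 u v) = u$1 * v$2 - v$1 * u$2"
  by (simp add: columns2_def det_2 transpose_def)

lemma columns2_nth [simp]:
  "columns2 u v $ i $ 1 = u $ i" "columns2 u v $ i $ 2 = v $ i"
  by (simp_all add: columns2_def transpose_def)

lemma ptolemy_eq: "ptolemy V x y = V x $ 1 * V y $ 2 - V y $ 1 * V x $ 2"
  by (simp add: ptolemy_def det_columns2)

lemma ptolemy_swap: "ptolemy V y x = - ptolemy V x y"
  by (simp add: ptolemy_eq)

lemma ptolemy_swap_eq_0_iff: "ptolemy V y x = 0 \<longleftrightarrow> ptolemy V x y = 0"
  using ptolemy_swap [of V x y] by simp

lemma det_vertex_matrix: "ptolemy V x y \<noteq> 0 \<Longrightarrow> det (vertex_matrix V (x, y)) = 1"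
  by (simp add: vertex_matrix_def det_columns2 ptolemy_eq diff_divide_distrib [symmetric])

lemma matrix_inv_2:
  fixes A :: "complex^2^2"
  assumes "det A \<noteq> 0"
  shows "A ** matrix_inv A = mat 1" "matrix_inv A ** A = mat 1"
proof -
  have "\<exists>B. A ** B = mat 1 \<and> B ** A = mat 1"
    using assms by (simp add: invertible_det_nz [symmetric] invertible_def)
  then have "A ** matrix_inv A = mat 1 \<and> matrix_inv A ** A = mat 1"
    unfolding matrix_inv_def by (rule someI_ex)
  then show "A ** matrix_inv A = mat 1" "matrix_inv A ** A = mat 1"
    by simp_all
qed

lemma matrix_inv_mult_cancel:
  fixes A B :: "complex^2^2"
  assumes "det A \<noteq> 0"
  shows "matrix_inv A ** (A ** B) = B"
  using assms by (simp add: matrix_mul_assoc matrix_inv_2)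

lemma det_matrix_inv:
  fixes A :: "complex^2^2"
  assumes "det A = 1"
  shows "det (matrix_inv A) = 1"
proof -
  have "det (matrix_inv A ** A) = 1"
    using assms by (simp add: matrix_inv_2 det_I)
  with assms show ?thesis by (simp add: det_mul)
qed

text \<open>The matrix of the crossing cocycle for arbitrary vectors at the ideal vertices, so that
  faces of two different octahedra can be compared without reference to their crossings.\<close>

definition transition :: "(overtex \<Rightarrow> complex^2) \<Rightarrow> oedge \<Rightarrow> complex^2^2" where
  "transition V = (\<lambda>(u, v). matrix_inv (vertex_matrix V u) ** vertex_matrix V v)"

lemma transition_short:
  assumes "ptolemy V x y \<noteq> 0" "ptolemy V x z \<noteq> 0"
  shows "transition V ((x, y), (x, z)) =
    columns2 (vector [1, 0]) (vector [ptolemy V z y / (ptolemy V x z * ptolemy V x y), 1])"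
    (is "_ = ?M")
proof -
  have "vertex_matrix V (x, z) = vertex_matrix V (x, y) ** ?M"
  proof -
    have "V z $ k / ptolemy V x z
        = V x $ k * (ptolemy V z y / (ptolemy V x z * ptolemy V x y)) + V y $ k / ptolemy V x y"
      if "k = 1 \<or> k = 2" for k
    proof -
      \<comment> \<open>Cramer's rule: three vectors of the plane satisfy a linear relation whose
        coefficients are their pairwise determinants.\<close>
      have "V z $ k * ptolemy V x y = V x $ k * ptolemy V z y + V y $ k * ptolemy V x z"
        using that by (auto simp: ptolemy_eq algebra_simps)
      with assms show ?thesis
        by (simp add: divide_simps)
    qed
    then show ?thesis
      by (simp add: mat2_eq_iff vertex_matrix_def matrix_matrix_mult_def sum_2)
  qed
  then show ?thesis
    using assms by (simp add: transition_def matrix_inv_mult_cancel det_vertex_matrix)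
qed

text \<open>Up to scaling, the two vertex matrices have the same columns in opposite order; the sign
  is the antisymmetry of the determinant.\<close>

lemma transition_long:
  assumes "ptolemy V x y \<noteq> 0"
  shows "transition V ((x, y), (y, x)) =
    columns2 (vector [0, ptolemy V x y]) (vector [- (1 / ptolemy V x y), 0])"
    (is "_ = ?M")
proof -
  have "vertex_matrix V (y, x) = vertex_matrix V (x, y) ** ?M"
    using assms
    by (simp add: mat2_eq_iff vertex_matrix_def matrix_matrix_mult_def sum_2 ptolemy_swap [of V y x])
  then show ?thesis
    using assms by (simp add: transition_def matrix_inv_mult_cancel det_vertex_matrix)
qed

section \<open>Elements of PSL(2) as matrices up to sign\<close>

lemma mult_uminus:
  fixes A B :: "complex^2^2"
  shows "- A ** B = - (A ** B)" "A ** - B = - (A ** B)"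
  by (simp_all add: mat2_eq_iff matrix_matrix_mult_def sum_2)

lemma psl_eq: "psl A = {A, - A}"
  by (auto simp: psl_def r_coset_def SL2_def mult_uminus)

lemma psl_uminus: "psl (- A) = psl A"
  by (auto simp: psl_eq)

lemma psl_in_carrier: "det A = 1 \<Longrightarrow> psl A \<in> carrier PSL2"
  by (auto simp: psl_def PSL2_def FactGroup_def RCOSETS_def SL2_def)

lemma psl_one: "\<one>\<^bsub>PSL2\<^esub> = psl (mat 1)"
  by (simp add: PSL2_def FactGroup_def psl_eq)

lemma psl_mult: "psl A \<otimes>\<^bsub>PSL2\<^esub> psl B = psl (A ** B)"
  by (auto simp: PSL2_def FactGroup_def psl_eq set_mult_def SL2_def mult_uminus)

text \<open>Products along a path of truncation vertices telescope: the middle vertex matrix cancels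
  against its inverse.\<close>

lemma psl_transition_mult:
  assumes "det (vertex_matrix V v) = 1"
  shows "psl (transition V (u, v)) \<otimes>\<^bsub>PSL2\<^esub> psl (transition V (v, w)) = psl (transition V (u, w))"
proof -
  have "vertex_matrix V v ** (matrix_inv (vertex_matrix V v) ** vertex_matrix V w)
      = vertex_matrix V w"
    using assms by (simp add: matrix_mul_assoc matrix_inv_2)
  then show ?thesis
    by (simp add: psl_mult transition_def matrix_mul_assoc [symmetric])
qed

lemma psl_transition_refl:
  assumes "det (vertex_matrix V u) = 1"
  shows "psl (transition V (u, u)) = \<one>\<^bsub>PSL2\<^esub>"
  using assms by (simp add: psl_one transition_def matrix_inv_2)

text \<open>Absorbs the unit from which \<open>foldr\<close> starts in the face condition.\<close>

lemma psl_transition_mult_one: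
  "psl (transition V e) \<otimes>\<^bsub>PSL2\<^esub> \<one>\<^bsub>PSL2\<^esub> = psl (transition V e)"
  by (simp add: psl_one psl_mult)

section \<open>Gluing equations and p-relations in terms of \<open>L\<close>\<close>

text \<open>
  The quantity \<open>L\<close>. In terms of it, the gluing equations and the p-relations no longer depend on
  the four cases.
\<close>

definition defect :: "bool \<Rightarrow> complex \<Rightarrow> complex \<Rightarrow> complex" where
  "defect ov c t = (if ov then 1 - t / c else 1 - c / t)"

text \<open>Writing \<open>L\<close> for the defects relative to \<open>c\<close>, the left-hand
  side of the equation is \<open>L_a L_e / (L_b L_d)\<close> if the segment starts over, and the
  inverse of this if it starts under.\<close>

lemma gluing_equation_defect:
  assumes "gluing_equation ov ov' a b c d e"
    and "a \<noteq> 0" "b \<noteq> 0" "c \<noteq> 0" "d \<noteq> 0" "e \<noteq> 0"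
    and "c \<noteq> a" "c \<noteq> b" "c \<noteq> d" "c \<noteq> e"
  shows "defect ov c a * defect ov' c e = defect ov c b * defect ov' c d"
  using assms
  by (cases ov; cases ov') (simp_all add: defect_def divide_simps, algebra+)

text \<open>The radicands are defects, and squaring removes both the sign ambiguity and the branch
  of the square root.\<close>

lemma p_relation_defect:
  assumes "p_relation ov ov' p1 p2 b c e"
  shows "p1\<^sup>2 * defect ov c b = p2\<^sup>2 * defect ov' c e"
proof -
  have *: "p1\<^sup>2 * x = p2\<^sup>2 * y"
    if "equal_up_to_sign (p1 * csqrt x) (p2 * csqrt y)" for x y
  proof -
    from that have "(p1 * csqrt x)\<^sup>2 = (p2 * csqrt y)\<^sup>2"
      by (auto simp: equal_up_to_sign_def)
    then show ?thesis by (simp add: power_mult_distrib)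
  qed
  show ?thesis
    using assms by (cases ov; cases ov') (auto simp: defect_def dest: *)
qed

section \<open>Ptolemy coordinates of an octahedral face\<close>

fun face_vertex :: "position \<Rightarrow> position \<Rightarrow> ideal_type \<Rightarrow> overtex" where
  "face_vertex x t Knot_type = (if over_pos x then Vinf else V0)"
| "face_vertex x t P_type = Side (if over_pos x then t else x)"
| "face_vertex x t Q_type = Side (if over_pos x then x else t)"

text \<open>Once the vertices of a face are indexed by their types, a type-preserving gluing of two
  faces is the identity on indices.\<close>

lemma face_vertex_vertex_type:
  assumes "v \<in> end_face x t" "over_pos t \<noteq> over_pos x"
  shows "face_vertex x t (vertex_type v) = v"
  using assms by (auto simp: end_face_def split: if_splits)

lemma ptolemy_crossing_vector:
  fixes p r w zz
  defines "V \<equiv> crossing_vector zz p r w"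
  assumes "r \<noteq> 0"
  shows "ptolemy V Vinf (Side x) = (if over_pos x then p * r / zz x else p * r)"
    and "ptolemy V V0 (Side x) = (if over_pos x then p * w else p * w * zz x)"
    and "ptolemy V V0 Vinf = r * w"
    and "over_pos x \<Longrightarrow> \<not> over_pos y \<Longrightarrow> ptolemy V (Side y) (Side x) = p\<^sup>2 * (zz y / zz x - 1)"
  using assms by (simp_all add: ptolemy_eq power2_eq_square field_simps)

text \<open>Of the two coordinates at the knot vertex, the ratio and the product are recorded. The
  product contains only the squares of \<open>r\<close> and \<open>w\<close>, whose signs are
  arbitrary; hence both coordinates are determined up to a common sign.\<close>

lemma ptolemy_face:
  fixes p r w zz x t
  defines "V \<equiv> crossing_vector zz p r w"
    and "K \<equiv> face_vertex x t Knot_type" and "P \<equiv> face_vertex x t P_type"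
    and "Q \<equiv> face_vertex x t Q_type"
  assumes "r \<noteq> 0" "zz x \<noteq> 0" "over_pos t \<noteq> over_pos x"
  shows "ptolemy V P Q = - p\<^sup>2 * defect (over_pos x) (zz x) (zz t)"
    and "ptolemy V K P = zz x * ptolemy V K Q"
    and "ptolemy V K P * ptolemy V K Q
      = p\<^sup>2 * (if over_pos x then r\<^sup>2 / zz x else zz x * w\<^sup>2)"
  using assms
  by (auto simp: ptolemy_crossing_vector defect_def power2_eq_square algebra_simps)

text \<open>
  If the Ptolemy coordinates of two faces differ only by a sign attached to the knot vertex, the
  signs cancel on short-edges and disappear in PSL(2) on long-edges.
\<close>

lemma psl_transition_face:
  fixes V V' :: "overtex \<Rightarrow> complex^2" and g g' :: "ideal_type \<Rightarrow> overtex"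
  assumes PQ: "ptolemy V (g P_type) (g Q_type) = ptolemy V' (g' P_type) (g' Q_type)"
    and KP: "ptolemy V (g Knot_type) (g P_type) = c * ptolemy V' (g' Knot_type) (g' P_type)"
    and KQ: "ptolemy V (g Knot_type) (g Q_type) = c * ptolemy V' (g' Knot_type) (g' Q_type)"
    and c: "c = 1 \<or> c = -1"
    and nz: "\<And>T T'. T \<noteq> T' \<Longrightarrow> ptolemy V (g T) (g T') \<noteq> 0"
    and nz': "\<And>T T'. T \<noteq> T' \<Longrightarrow> ptolemy V' (g' T) (g' T') \<noteq> 0"
    and edge: "S \<noteq> T" "(S' = S \<and> S \<noteq> T') \<or> (S' = T \<and> T' = S)"
  shows "psl (transition V ((g S, g T), (g S', g T')))
       = psl (transition V' ((g' S, g' T), (g' S', g' T')))"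
proof -
  define s where "s T = (if T = Knot_type then c else 1)" for T
  have s: "s T = 1 \<or> s T = -1" for T
    using c by (auto simp: s_def)
  have pt: "ptolemy V (g T) (g T') = s T * s T' * ptolemy V' (g' T) (g' T')" for T T'
  proof (cases "T = T'")
    case True
    then show ?thesis by (simp add: ptolemy_eq)
  next
    case False
    then show ?thesis
      using PQ KP KQ
      by (cases T; cases T')
        (simp_all add: s_def ptolemy_swap [of V "g Q_type" "g P_type"]
          ptolemy_swap [of V "g P_type" "g Knot_type"] ptolemy_swap [of V "g Q_type" "g Knot_type"]
          ptolemy_swap [of V' "g' Q_type" "g' P_type"]
          ptolemy_swap [of V' "g' P_type" "g' Knot_type"]
          ptolemy_swap [of V' "g' Q_type" "g' Knot_type"])
  qed
  from edge(2) show ?thesis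
  proof
    assume *: "S' = S \<and> S \<noteq> T'"
    \<comment> \<open>The sign of \<open>S\<close> occurs twice in the denominator, those of
      \<open>T\<close> and \<open>T'\<close> once above and once below.\<close>
    have "ptolemy V (g T') (g T) / (ptolemy V (g S) (g T') * ptolemy V (g S) (g T))
        = ptolemy V' (g' T') (g' T) / (ptolemy V' (g' S) (g' T') * ptolemy V' (g' S) (g' T))"
      using s [of S] s [of T] s [of T'] by (auto simp: pt)
    with * edge(1) show ?thesis
      by (simp add: transition_short nz nz')
  next
    assume *: "S' = T \<and> T' = S"
    have "ptolemy V (g S) (g T) = ptolemy V' (g' S) (g' T)
        \<or> ptolemy V (g S) (g T) = - ptolemy V' (g' S) (g' T)"
      using s [of S] s [of T] by (auto simp: pt)
    then have "transition V ((g S, g T), (g T, g S)) = transition V' ((g' S, g' T), (g' T, g' S))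
      \<or> transition V ((g S, g T), (g T, g S)) = - transition V' ((g' S, g' T), (g' T, g' S))"
      using edge(1) by (auto simp: transition_long nz nz' mat2_eq_iff)
    with * show ?thesis by (auto simp: psl_uminus)
  qed
qed

text \<open>
  By \<open>ptolemy_face\<close>, the right-hand sides are \<open>KP KQ / p\<^sup>2\<close>.
\<close>

lemma defect_difference_outgoing:
  assumes "crossing_roots D z r w" "(i, x) \<in> outgoing D" "\<And>y. z (seg D (i, y)) \<noteq> 0"
  shows "defect (over_pos x) (z (seg D (i, x))) (z (seg D (i, start_neighbour RightSide x))) -
      defect (over_pos x) (z (seg D (i, x))) (z (seg D (i, start_neighbour LeftSide x)))
    = (if over_pos x then (r i)\<^sup>2 / z (seg D (i, x)) else z (seg D (i, x)) * (w i)\<^sup>2)"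
  using assms
  by (cases x) (auto simp: crossing_roots_def outgoing_def over_pos_def defect_def divide_simps
      algebra_simps split: if_splits)

text \<open>A strand has the same slot on its right where it enters and where it leaves the
  crossing: \<open>Pb\<close> for the under-strand, and \<open>Pa\<close> or \<open>Pc\<close> for
  the over-strand at a positive or negative crossing. The sign-dependent choice of \<open>r\<close>
  matches this, so incoming and outgoing ends give the same formula.\<close>

lemma defect_difference_incoming:
  assumes "crossing_roots D z r w" "(j, y) \<in> incoming D" "\<And>x. z (seg D (j, x)) \<noteq> 0"
  shows "defect (over_pos y) (z (seg D (j, y))) (z (seg D (j, end_neighbour RightSide y))) -
      defect (over_pos y) (z (seg D (j, y))) (z (seg D (j, end_neighbour LeftSide y)))
    = (if over_pos y then (r j)\<^sup>2 / z (seg D (j, y)) else z (seg D (j, y)) * (w j)\<^sup>2)"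
  using assms
  by (cases y) (auto simp: crossing_roots_def incoming_def over_pos_def defect_def divide_simps
      algebra_simps split: if_splits)

lemma over_pos_neighbour:
  "over_pos (start_neighbour sd x) \<noteq> over_pos x" "over_pos (end_neighbour sd x) \<noteq> over_pos x"
  by (cases sd; cases x; simp add: over_pos_def)+

lemma octahedron_edge_cases:
  assumes "((x, y), (x', y')) \<in> edges truncated_octahedron"
  shows "x \<noteq> y" "(x' = x \<and> x \<noteq> y') \<or> (x' = y \<and> y' = x)"
  using assms by (auto simp: edges_def truncated_octahedron_def)

section \<open>Comparison of glued faces\<close>

locale knot_octahedra =
  fixes D :: "'s diagram" and z :: "'s \<Rightarrow> complex" and p r w :: "nat \<Rightarrow> complex"
  assumes segment_variables: "segment_variables D z"
    and gluing: "satisfies_gluing_equations D z"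
    and p_nonzero: "\<forall>i<crossings D. p i \<noteq> 0"
    and p_relations: "satisfies_p_relations D z p"
    and roots: "crossing_roots D z r w"
begin

abbreviation zs :: "nat \<Rightarrow> position \<Rightarrow> complex" where
  "zs i x \<equiv> z (seg D (i, x))"

abbreviation V :: "nat \<Rightarrow> overtex \<Rightarrow> complex^2" where
  "V i \<equiv> crossing_vector (zs i) (p i) (r i) (w i)"

lemma crossing_cocycle_transition: "crossing_cocycle D z p r w i = transition (V i)"
  by (simp add: crossing_cocycle_def transition_def fun_eq_iff Let_def)

lemma zs_nonzero: "i < crossings D \<Longrightarrow> zs i x \<noteq> 0"
  using segment_variables by (auto simp: segment_variables_def segments_def)

lemma zs_eq_iff: "i < crossings D \<Longrightarrow> zs i x = zs i y \<longleftrightarrow> x = y"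
  using segment_variables by (auto simp: segment_variables_def inj_def)

lemma r_nonzero: "i < crossings D \<Longrightarrow> r i \<noteq> 0"
  using roots zs_eq_iff [of i Pa Pc]
  by (auto simp: crossing_roots_def split: if_splits)

lemma w_nonzero: "i < crossings D \<Longrightarrow> w i \<noteq> 0"
proof
  assume i: "i < crossings D" and "w i = 0"
  with roots have "1 / zs i Pd = 1 / zs i Pb"
    by (auto simp: crossing_roots_def)
  with i show False
    using zs_eq_iff [of i Pd Pb] zs_nonzero [of i] by (simp add: field_simps)
qed

lemma defect_nonzero: "i < crossings D \<Longrightarrow> x \<noteq> t \<Longrightarrow> defect ov (zs i x) (zs i t) \<noteq> 0"
  using zs_eq_iff [of i x t] zs_nonzero [of i] by (auto simp: defect_def field_simps)

text \<open>Neighbouring slots lie on different strands, so explicit formulas cover all edges: the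
  axis, the edges from its ends to side vertices, and one side edge joining an over-slot to an
  under-slot.\<close>

lemma ptolemy_tetrahedron_nonzero:
  assumes "i < crossings D" "T \<in> tetrahedra" "x \<in> T" "y \<in> T" "x \<noteq> y"
  shows "ptolemy (V i) x y \<noteq> 0"
proof -
  have *: "ptolemy (V i) Vinf (Side x) \<noteq> 0" "ptolemy (V i) V0 (Side x) \<noteq> 0"
    "ptolemy (V i) V0 Vinf \<noteq> 0" for x
    using assms(1) r_nonzero w_nonzero zs_nonzero p_nonzero
    by (simp_all add: ptolemy_crossing_vector)
  have **: "ptolemy (V i) (Side y) (Side x) \<noteq> 0" if "over_pos x" "\<not> over_pos y" for x y
    using that assms(1) r_nonzero p_nonzero zs_nonzero [of i] zs_eq_iff [of i y x]
    by (auto simp: ptolemy_crossing_vector)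
  have ***: "ptolemy (V i) (Side x) (Side (next_pos x)) \<noteq> 0" for x
    using ** [of x "next_pos x"] ** [of "next_pos x" x]
      ptolemy_swap [of "V i" "Side x" "Side (next_pos x)"]
    by (cases x) (auto simp: over_pos_def)
  from assms(2) obtain t where T: "T = {V0, Vinf, Side t, Side (next_pos t)}"
    by (auto simp: tetrahedra_def)
  show ?thesis
    using assms(3,4,5) * *** ptolemy_swap_eq_0_iff unfolding T by (metis empty_iff insert_iff)
qed

lemma joined_crossings:
  assumes "joins D (i, x) (j, y)"
  shows "i < crossings D" "j < crossings D" "zs i x = zs j y"
  using assms by (auto simp: joins_def outgoing_def incoming_def)

text \<open>By \<open>ptolemy_face\<close>, this is the equality of the coordinates
  \<open>PQ\<close> of two glued faces.\<close>

lemma joined_defects: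
  assumes J: "joins D (i, x) (j, y)"
  shows "(p i)\<^sup>2 * defect (over_pos x) (zs i x) (zs i (start_neighbour sd x))
       = (p j)\<^sup>2 * defect (over_pos y) (zs j y) (zs j (end_neighbour sd y))"
proof -
  note ij = joined_crossings [OF J]
  have ne: "x \<noteq> start_neighbour s x" "y \<noteq> end_neighbour s y" for s
    using over_pos_neighbour [of s x] over_pos_neighbour [of s y] by metis+
  let ?d = "\<lambda>s. defect (over_pos x) (zs i x) (zs i (start_neighbour s x))"
  let ?e = "\<lambda>s. defect (over_pos y) (zs j y) (zs j (end_neighbour s y))"
  have R: "(p i)\<^sup>2 * ?d RightSide = (p j)\<^sup>2 * ?e RightSide"
    using p_relations J p_relation_defect ij(3) unfolding satisfies_p_relations_def by metis
  have "?d LeftSide * ?e RightSide = ?d RightSide * ?e LeftSide"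
  proof -
    have "gluing_equation (over_pos x) (over_pos y)
      (zs i (start_neighbour LeftSide x)) (zs i (start_neighbour RightSide x)) (zs i x)
      (zs j (end_neighbour LeftSide y)) (zs j (end_neighbour RightSide y))"
      using gluing J unfolding satisfies_gluing_equations_def by blast
    moreover have "zs i x \<noteq> zs i (start_neighbour s x)" "zs i x \<noteq> zs j (end_neighbour s y)" for s
      using ij ne zs_eq_iff by metis+
    ultimately show ?thesis
      using gluing_equation_defect zs_nonzero ij by metis
  qed
  \<comment> \<open>The relation of defects is multiplied by the square of \<open>p i\<close> so
    that \<open>R\<close> applies; the nonzero factor \<open>?e RightSide\<close> then
    cancels.\<close>
  then have "?e RightSide * ((p i)\<^sup>2 * ?d LeftSide) = ((p i)\<^sup>2 * ?d RightSide) * ?e LeftSide"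
    by (simp only: ac_simps)
  also have "\<dots> = ?e RightSide * ((p j)\<^sup>2 * ?e LeftSide)"
    unfolding R by (simp only: ac_simps)
  finally have "(p i)\<^sup>2 * ?d LeftSide = (p j)\<^sup>2 * ?e LeftSide"
    using defect_nonzero [OF ij(2) ne(2)]
    by (simp del: start_neighbour.simps end_neighbour.simps)
  with R show ?thesis
    by (cases sd) simp_all
qed

lemma ptolemy_face_nonzero:
  assumes i: "i < crossings D" and t: "over_pos t \<noteq> over_pos x" and "T \<noteq> T'"
  shows "ptolemy (V i) (face_vertex x t T) (face_vertex x t T') \<noteq> 0"
proof -
  note f = ptolemy_face [where p = "p i" and r = "r i" and w = "w i" and zz = "zs i",
      OF r_nonzero [OF i] zs_nonzero [OF i] t]
  let ?P = "\<lambda>T T'. ptolemy (V i) (face_vertex x t T) (face_vertex x t T')"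
  have "x \<noteq> t"
    using t by auto
  then have "?P P_type Q_type \<noteq> 0"
    unfolding f(1) using i p_nonzero defect_nonzero by simp
  moreover have "?P Knot_type P_type * ?P Knot_type Q_type \<noteq> 0"
    unfolding f(3) using i p_nonzero r_nonzero w_nonzero zs_nonzero by simp
  then have "?P Knot_type P_type \<noteq> 0" "?P Knot_type Q_type \<noteq> 0"
    by (simp_all del: face_vertex.simps)
  moreover have "?P T T' = 0 \<longleftrightarrow> ?P T' T = 0" for T T'
    by (rule ptolemy_swap_eq_0_iff)
  ultimately show ?thesis
    using \<open>T \<noteq> T'\<close> by (cases T; cases T'; metis)
qed

lemma psl_glued:
  assumes J: "joins D (i, x) (j, y)"
    and e: "e \<in> edges truncated_octahedron" and f: "f \<in> edges truncated_octahedron"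
    and "edge_vertices e \<subseteq> end_face x (start_neighbour sd x)"
    and "edge_vertices f \<subseteq> end_face y (end_neighbour sd y)"
    and "edge_type e = edge_type f"
  shows "psl (transition (V i) e) = psl (transition (V j) f)"
proof -
  note ij = joined_crossings [OF J]
  define g where "g = face_vertex x (start_neighbour sd x)"
  define g' where "g' = face_vertex y (end_neighbour sd y)"
  note F = ptolemy_face [where p = "p i" and r = "r i" and w = "w i" and zz = "zs i",
      OF r_nonzero [OF ij(1)] zs_nonzero [OF ij(1)] over_pos_neighbour(1) [of sd x], folded g_def]
  note F' = ptolemy_face [where p = "p j" and r = "r j" and w = "w j" and zz = "zs j",
      OF r_nonzero [OF ij(2)] zs_nonzero [OF ij(2)] over_pos_neighbour(2) [of sd y], folded g'_def]
  let ?P = "\<lambda>T T'. ptolemy (V i) (g T) (g T')" and ?P' = "\<lambda>T T'. ptolemy (V j) (g' T) (g' T')"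
  have "?P Knot_type P_type * ?P Knot_type Q_type = ?P' Knot_type P_type * ?P' Knot_type Q_type"
  proof -
    have out: "(i, x) \<in> outgoing D" and inc: "(j, y) \<in> incoming D"
      using J by (auto simp: joins_def)
    show ?thesis
      \<comment> \<open>Both products become differences of right-hand and left-hand defects, and
        these agree side by side.\<close>
      unfolding F(3) F'(3)
      unfolding defect_difference_outgoing [OF roots out zs_nonzero [OF ij(1)], symmetric]
        defect_difference_incoming [OF roots inc zs_nonzero [OF ij(2)], symmetric]
        right_diff_distrib joined_defects [OF J] ..
  qed
  \<comment> \<open>Each product is the square of \<open>KQ\<close> times the variable of the
    segment, which is common to both ends and nonzero. The sign \<open>c\<close> relating the two
    values of \<open>KQ\<close> then also relates those of \<open>KP\<close>.\<close>
  then have "(?P Knot_type Q_type)\<^sup>2 = (?P' Knot_type Q_type)\<^sup>2"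
    using ij zs_nonzero [of j y] by (simp add: F(2) F'(2) power2_eq_square)
  then obtain c where c: "c = 1 \<or> c = -1" "?P Knot_type Q_type = c * ?P' Knot_type Q_type"
    unfolding power2_eq_iff by (metis mult_1 mult_minus1)
  obtain u v u' v' where e_eq: "e = ((u, v), (u', v'))"
    by (metis surj_pair)
  obtain a b a' b' where f_eq: "f = ((a, b), (a', b'))"
    by (metis surj_pair)
  define S T S' T' where defs: "S = vertex_type u" "T = vertex_type v"
    "S' = vertex_type u'" "T' = vertex_type v'"
  have E: "u = g S" "v = g T" "u' = g S'" "v' = g T'"
    using assms(4) over_pos_neighbour(1) face_vertex_vertex_type
    by (auto simp: g_def defs e_eq)
  have E': "a = g' S" "b = g' T" "a' = g' S'" "b' = g' T'"
    using assms(5,6) over_pos_neighbour(2) face_vertex_vertex_type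
    by (auto simp: g'_def defs e_eq f_eq)
  \<comment> \<open>Distinct vertices have distinct types here, since by \<open>E\<close> each
    vertex is the value of \<open>g\<close> at its type.\<close>
  have "S \<noteq> T" "(S' = S \<and> S \<noteq> T') \<or> (S' = T \<and> T' = S)"
    using octahedron_edge_cases [OF e [unfolded e_eq]] E(1,2,4) defs by metis+
  then show ?thesis
    unfolding e_eq f_eq E E'
    using c ij F(2) F'(2) F(1) F'(1) joined_defects [OF J, of sd]
      ptolemy_face_nonzero [OF ij(1) over_pos_neighbour(1)]
      ptolemy_face_nonzero [OF ij(2) over_pos_neighbour(2)]
    by (intro psl_transition_face [where c = c]) (simp_all add: g_def g'_def)
qed

section \<open>Descent to the edges of the exterior\<close>

abbreviation psl_at :: "nat \<times> oedge \<Rightarrow> (complex^2^2) set" where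
  "psl_at u \<equiv> psl (transition (V (fst u)) (snd u))"

lemma psl_edge_class:
  assumes "v \<in> edge_class D u"
  shows "psl_at v = psl_at u"
proof -
  have glued: "psl_at a = psl_at b" if "glued_edges D a b" for a b
  proof -
    from that obtain i x j y sd e f where "a = (i, e)" "b = (j, f)" "joins D (i, x) (j, y)"
      "e \<in> edges truncated_octahedron" "f \<in> edges truncated_octahedron"
      "edge_vertices e \<subseteq> end_face x (start_neighbour sd x)"
      "edge_vertices f \<subseteq> end_face y (end_neighbour sd y)" "edge_type e = edge_type f"
      unfolding glued_edges_def by (elim exE conjE) rule
    then show ?thesis
      using psl_glued by simp
  qed
  have "equivclp (glued_edges D) u v"
    using assms by (simp add: edge_class_def)
  then show ?thesis
  proof (induction rule: equivclp_induct)
    case base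
    show ?case ..
  next
    case (step v v')
    with glued [of v v'] glued [of v' v] show ?case by auto
  qed
qed

lemma edge_class_refl: "u \<in> edge_class D u"
  by (simp add: edge_class_def)

definition exterior_cocycle :: "(nat \<times> oedge) set \<Rightarrow> (complex^2^2) set" where
  "exterior_cocycle c = psl_at (SOME u. u \<in> c)"

text \<open>Subsets are allowed because the reverse of an edge class is defined as an image; its
  inclusion in the class of the reversed edge is enough to evaluate the cocycle there.\<close>

lemma exterior_cocycle_subset_class:
  assumes "c \<noteq> {}" "c \<subseteq> edge_class D u"
  shows "exterior_cocycle c = psl_at u"
proof -
  have "(SOME v. v \<in> c) \<in> c"
    using assms(1) unfolding some_in_eq .
  with assms(2) have "(SOME v. v \<in> c) \<in> edge_class D u"
    by (rule subsetD)
  then show ?thesis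
    unfolding exterior_cocycle_def by (rule psl_edge_class)
qed

lemma exterior_cocycle_class: "exterior_cocycle (edge_class D u) = psl_at u"
  using edge_class_refl [of u] by (intro exterior_cocycle_subset_class) auto

text \<open>Reversal keeps the vertex set of an edge and permutes the types of both edges in the
  same way, so it respects the gluing.\<close>

lemma glued_edges_swap:
  assumes "glued_edges D u v"
  shows "glued_edges D (map_prod id prod.swap u) (map_prod id prod.swap v)"
proof -
  from assms obtain i x j y sd e f
    where eq: "u = (i, e)" "v = (j, f)" and J: "joins D (i, x) (j, y)"
      and edges: "e \<in> edges truncated_octahedron" "f \<in> edges truncated_octahedron"
      and vertices: "edge_vertices e \<subseteq> end_face x (start_neighbour sd x)"
        "edge_vertices f \<subseteq> end_face y (end_neighbour sd y)"
      and type: "edge_type e = edge_type f"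
    unfolding glued_edges_def by (elim exE conjE) rule
  have "prod.swap e' \<in> edges truncated_octahedron" if "e' \<in> edges truncated_octahedron" for e'
    using that by (auto simp: edges_def truncated_octahedron_def insert_commute)
  note swap_edges = edges [THEN this]
  have "edge_vertices (prod.swap e') = edge_vertices e'" for e'
    by (cases e' rule: edge_vertices.cases) auto
  note swap_vertices = vertices [folded this [of e] this [of f]]
  have swap_type: "edge_type (prod.swap e) = edge_type (prod.swap f)"
    using type by (cases e rule: edge_type.cases; cases f rule: edge_type.cases) auto
  have "map_prod id prod.swap u = (i, prod.swap e)" "map_prod id prod.swap v = (j, prod.swap f)"
    by (simp_all add: eq)
  with J swap_edges swap_vertices swap_type show ?thesis
    unfolding glued_edges_def by blast
qed

lemma exterior_cocycle_reverse:
  "exterior_cocycle (map_prod id prod.swap ` edge_class D (i, e)) = psl_at (i, prod.swap e)"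
proof (rule exterior_cocycle_subset_class)
  have "equivclp (glued_edges D) (map_prod id prod.swap u) (map_prod id prod.swap v)"
    if "equivclp (glued_edges D) u v" for u v
    using that
  proof (induction rule: equivclp_induct)
    case base
    show ?case by simp
  next
    case (step v v')
    then show ?case
      by (meson equivclp_into_equivclp glued_edges_swap)
  qed
  then show "map_prod id prod.swap ` edge_class D (i, e) \<subseteq> edge_class D (i, prod.swap e)"
    by (fastforce simp: edge_class_def)
  show "map_prod id prod.swap ` edge_class D (i, e) \<noteq> {}"
    using edge_class_refl [of "(i, e)"] by auto
qed

section \<open>The cocycle conditions\<close>

lemma det_vertex_matrix_tetrahedron:
  assumes "i < crossings D" "T \<in> tetrahedra" "{x, y} \<subseteq> T" "x \<noteq> y"
  shows "det (vertex_matrix (V i) (x, y)) = 1"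
  using assms by (simp add: det_vertex_matrix ptolemy_tetrahedron_nonzero)

lemma det_vertex_matrix_edge:
  assumes "i < crossings D" "(u, v) \<in> edges truncated_octahedron"
  shows "det (vertex_matrix (V i) u) = 1" "det (vertex_matrix (V i) v) = 1"
  using assms
  by (auto simp: edges_def truncated_octahedron_def intro!: det_vertex_matrix_tetrahedron)

lemma short_edge_unipotent:
  assumes "i < crossings D" "e \<in> short_edges truncated_octahedron"
  shows "transition (V i) e \<in> unipotent"
proof -
  from assms obtain x y z' where e: "e = ((x, y), (x, z'))"
    and "ptolemy (V i) x y \<noteq> 0" "ptolemy (V i) x z' \<noteq> 0"
    by (auto simp: truncated_octahedron_def ptolemy_tetrahedron_nonzero)
  then show ?thesis
    by (simp add: transition_short unipotent_def)
qed

lemma long_edge_counter_diagonal: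
  assumes "i < crossings D" "e \<in> long_edges truncated_octahedron"
  shows "transition (V i) e \<in> counter_diagonal"
proof -
  from assms obtain x y where e: "e = ((x, y), (y, x))" and "ptolemy (V i) x y \<noteq> 0"
    by (auto simp: truncated_octahedron_def ptolemy_tetrahedron_nonzero)
  then show ?thesis
    by (simp add: transition_long counter_diagonal_def SL2_def det_columns2)
qed

text \<open>The edges of a face form a closed path of truncation vertices, so the product telescopes
  to a transition from a vertex to itself.\<close>

lemma face_product:
  assumes i: "i < crossings D" and "F \<in> faces truncated_octahedron"
  shows "foldr (\<lambda>e g. psl_at (i, e) \<otimes>\<^bsub>PSL2\<^esub> g) F \<one>\<^bsub>PSL2\<^esub> = \<one>\<^bsub>PSL2\<^esub>"
proof -
  note d = det_vertex_matrix_tetrahedron [OF i]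
  note simps = psl_transition_mult_one psl_transition_mult psl_transition_refl
  from assms(2) consider
    (triangle) x y z' t T where "T \<in> tetrahedra" "{x, y, z', t} \<subseteq> T" "distinct [x, y, z', t]"
      "F = [((x, y), (x, z')), ((x, z'), (x, t)), ((x, t), (x, y))]"
  | (hexagon) x y z' T where "T \<in> tetrahedra" "{x, y, z'} \<subseteq> T" "distinct [x, y, z']"
      "F = [((x, y), (y, x)), ((y, x), (y, z')), ((y, z'), (z', y)),
         ((z', y), (z', x)), ((z', x), (x, z')), ((x, z'), (x, y))]"
    by (simp add: truncated_octahedron_def) blast
  then show ?thesis
  proof cases
    case triangle
    with d [of T x y] d [of T x z'] d [of T x t] show ?thesis
      by (simp add: simps)
  next
    case hexagon
    then have "y \<noteq> x" "z' \<noteq> x" "z' \<noteq> y"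
      by auto
    with hexagon d [of T x y] d [of T y x] d [of T x z'] d [of T z' x] d [of T y z'] d [of T z' y]
    show ?thesis
      by (simp add: simps)
  qed
qed

lemma natural_cocycle_exterior:
  "natural_cocycle PSL2 (psl ` unipotent) (psl ` counter_diagonal)
     (exterior_complex D) exterior_cocycle"
proof -
  have "exterior_cocycle c \<in> carrier PSL2 \<and>
      exterior_cocycle c \<otimes>\<^bsub>PSL2\<^esub> exterior_cocycle (reverse_edge (exterior_complex D) c) = \<one>\<^bsub>PSL2\<^esub>"
    if "c \<in> edges (exterior_complex D)" for c
  proof -
    from that obtain i u v where c: "c = edge_class D (i, (u, v))" and i: "i < crossings D"
      and e: "(u, v) \<in> edges truncated_octahedron"
      by (auto simp: edges_def exterior_complex_def)
    note d = det_vertex_matrix_edge [OF i e]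
    have rev: "reverse_edge (exterior_complex D) c = map_prod id prod.swap ` c"
      by (simp add: exterior_complex_def truncated_octahedron_def)
    have "det (transition (V i) (u, v)) = 1"
      using d by (simp add: transition_def det_mul det_matrix_inv)
    with d show ?thesis
      unfolding rev unfolding c exterior_cocycle_reverse exterior_cocycle_class
      by (simp add: psl_in_carrier psl_transition_mult psl_transition_refl)
  qed
  moreover have "foldr (\<lambda>e g. exterior_cocycle e \<otimes>\<^bsub>PSL2\<^esub> g) F \<one>\<^bsub>PSL2\<^esub> = \<one>\<^bsub>PSL2\<^esub>"
    if "F \<in> faces (exterior_complex D)" for F
    using that face_product
    by (auto simp: exterior_complex_def foldr_map o_def exterior_cocycle_class)
  moreover have "exterior_cocycle c \<in> psl ` unipotent"
    if "c \<in> short_edges (exterior_complex D)" for c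
    using that short_edge_unipotent by (auto simp: exterior_complex_def exterior_cocycle_class)
  moreover have "exterior_cocycle c \<in> psl ` counter_diagonal"
    if "c \<in> long_edges (exterior_complex D)" for c
    using that long_edge_counter_diagonal
    by (auto simp: exterior_complex_def exterior_cocycle_class)
  ultimately show ?thesis
    unfolding natural_cocycle_def by blast
qed

end

theorem theorem3p3:
  fixes D :: "'s diagram" and z :: "'s \<Rightarrow> complex" and p r w :: "nat \<Rightarrow> complex"
  assumes "oriented_knot_diagram D"
    and "segment_variables D z"
    and "satisfies_gluing_equations D z"
    and "\<forall>i<crossings D. p i \<noteq> 0"
    and "satisfies_p_relations D z p"
    and "crossing_roots D z r w"
  shows "(\<forall>i<crossings D. \<forall>j<crossings D.
            \<forall>e\<in>edges truncated_octahedron. \<forall>f\<in>edges truncated_octahedron.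
              edge_class D (i, e) = edge_class D (j, f) \<longrightarrow>
              psl (crossing_cocycle D z p r w i e) = psl (crossing_cocycle D z p r w j f)) \<and>
         (\<exists>\<beta>. natural_cocycle PSL2 (psl ` unipotent) (psl ` counter_diagonal)
                 (exterior_complex D) \<beta> \<and>
              (\<forall>i<crossings D. \<forall>e\<in>edges truncated_octahedron.
                 \<beta> (edge_class D (i, e)) = psl (crossing_cocycle D z p r w i e)))"
proof -
  interpret knot_octahedra D z p r w
    using assms by unfold_locales
  have "psl (crossing_cocycle D z p r w i e) = psl (crossing_cocycle D z p r w j f)"
    if "edge_class D (i, e) = edge_class D (j, f)" for i j e f
    using psl_edge_class [of "(i, e)" "(j, f)"] edge_class_refl [of "(i, e)"] that
    by (simp add: crossing_cocycle_transition)
  moreover have "exterior_cocycle (edge_class D (i, e)) = psl (crossing_cocycle D z p r w i e)"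
    for i e
    by (simp add: exterior_cocycle_class crossing_cocycle_transition)
  ultimately show ?thesis
    using natural_cocycle_exterior by blast
qed

end
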